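(* Let $\gamma\in\mathbb{R}$ be a given performance threshold. Consider the nonconvex problem $(\mathrm{P})$ in the variables $K\in\mathbb{R}^{n_u\times n_x}$, $P\in\mathbb{S}^{n_x}$: $$\min_{K,P}\ \|K\|_1\quad\text{s.t.}\quad P\succ 0,\quad \begin{bmatrix} \mathrm{Sym}(P(A+BK)) & PG & (C+DK)^\top\\ G^\top P & -\gamma I & H^\top\\ C+DK & H & -\gamma I\end{bmatrix}\preceq 0,$$ and, for a linearization point $(\tilde K,\tilde P)\in\mathbb{R}^{n_u\times n_x}\times\mathbb{S}^{n_x}$, the convex problem $(\mathrm{R}_{\tilde K,\tilde P})$ in the same variables: $$\min_{K,P}\ \|K\|_1\quad\text{s.t.}\quad P\succ 0,\quad \begin{bmatrix} -L_f(K,P;\tilde K,\tilde P) & * & * & *\\ \frac{1}{\sqrt2}(A+BK+P) & -I & * & *\\ G^\top P & 0 & -\gamma I & *\\ C+DK & 0 & H & -\gamma I\end{bmatrix}\preceq 0 .$$ Then: (1) for every linearization point $(\tilde K,\tilde P)$, every feasible solution $(\bar K,\bar P)$ of $(\mathrm{R}_{\tilde K,\tilde P})$ is a feasible solution of $(\mathrm{P})$; (2) for every feasible solution $(\hat K,\hat P)$ of $(\mathrm{P})$, if one takes $\tilde K=\hat K$ and $\tilde P=\hat P$, then $(\hat K,\hat P)$ is a feasible solution of $(\mathrm{R}_{\hat K,\hat P})$.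
   Context: The data are real matrices $A\in\mathbb{R}^{n_x\times n_x}$, $B\in\mathbb{R}^{n_x\times n_u}$, $G\in\mathbb{R}^{n_x\times n_d}$, $C\in\mathbb{R}^{n_z\times n_x}$, $D\in\mathbb{R}^{n_z\times n_u}$, $H\in\mathbb{R}^{n_z\times n_d}$ of the linear system $\dot x=Ax+Bu+Gd$, $z=Cx+Du+Hd$, with $(A,B)$ stabilizable (standing assumption). Notation: $\mathbb{S}^n$ is the space of real symmetric $n\times n$ matrices; $\mathrm{Sym}(M)=M+M^\top$; $\succ,\succeq,\preceq$ denote the (semi)definite order on symmetric matrices; $\|K\|_1=\sum_{i,j}|K_{ij}|$; $*$ in a symmetric block matrix denotes the block determined by symmetry; $I$ is the identity matrix of the appropriate size. With $f(K,P)=\frac12(A+BK-P)^\top(A+BK-P)$, the linearization of $f$ around $(\tilde K,\tilde P)$ is $$L_f(K,P;\tilde K,\tilde P)= f(\tilde K,\tilde P)+\tfrac12\big[B(K-\tilde K)-(P-\tilde P)\big]^\top(A+B\tilde K-\tilde P)+\tfrac12(A+B\tilde K-\tilde P)^\top\big[B(K-\tilde K)-(P-\tilde P)\big].$$ A feasible solution of a problem is a pair $(K,P)$ satisfying all its constraints. *)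

theory Defs
  imports "HOL-Analysis.Analysis"
begin

definition symmetric_matrices :: "(real^'n^'n) set" where
  "symmetric_matrices = {M. transpose M = M}"

definition Sym :: "real^'n^'n \<Rightarrow> real^'n^'n" where
  "Sym M = M + transpose M"

text \<open>The definite and semidefinite orders are orders on symmetric matrices only, so both sides are
  required to be symmetric.\<close>

definition loewner_le :: "real^'n^'n \<Rightarrow> real^'n^'n \<Rightarrow> bool" (infix "\<preceq>\<^sub>m" 50) where
  "M \<preceq>\<^sub>m N \<longleftrightarrow> M \<in> symmetric_matrices \<and> N \<in> symmetric_matrices \<and>
     (\<forall>x. 0 \<le> x \<bullet> ((N - M) *v x))"

definition loewner_less :: "real^'n^'n \<Rightarrow> real^'n^'n \<Rightarrow> bool" (infix "\<prec>\<^sub>m" 50) where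
  "M \<prec>\<^sub>m N \<longleftrightarrow> M \<in> symmetric_matrices \<and> N \<in> symmetric_matrices \<and>
     (\<forall>x. x \<noteq> 0 \<longrightarrow> 0 < x \<bullet> ((N - M) *v x))"

definition entrywise_norm1 :: "real^'n^'m \<Rightarrow> real" where
  "entrywise_norm1 K = (\<Sum>i\<in>UNIV. \<Sum>j\<in>UNIV. \<bar>K $ i $ j\<bar>)"

text \<open>Complex eigenvalues of a real matrix are those of its entrywise embedding into the complex
  matrices.\<close>

definition hurwitz :: "real^'n^'n \<Rightarrow> bool" where
  "hurwitz M \<longleftrightarrow> (\<forall>(l::complex) v. v \<noteq> 0 \<and>
     (\<chi> i j. complex_of_real (M $ i $ j)) *v v = l *s v \<longrightarrow> Re l < 0)"

definition stabilizable :: "real^'x^'x \<Rightarrow> real^'u^'x \<Rightarrow> bool" where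
  "stabilizable A B \<longleftrightarrow> (\<exists>K :: real^'x^'u. hurwitz (A + B ** K))"

text \<open>Block matrices are indexed by sum types: \<open>|||\<close> puts blocks side by side and \<open>///\<close>, which binds
  weaker, stacks block rows.\<close>

definition hcat :: "real^'a^'r \<Rightarrow> real^'b^'r \<Rightarrow> real^('a + 'b)^'r" (infixr "|||" 55) where
  "M ||| N = (\<chi> i j. case j of Inl a \<Rightarrow> M $ i $ a | Inr b \<Rightarrow> N $ i $ b)"

definition vcat :: "real^'c^'a \<Rightarrow> real^'c^'b \<Rightarrow> real^'c^('a + 'b)" (infixr "'/'/'/" 52) where
  "M /// N = (\<chi> i. case i of Inl a \<Rightarrow> M $ a | Inr b \<Rightarrow> N $ b)"

definition f_fn :: "real^'x^'x \<Rightarrow> real^'u^'x \<Rightarrow> real^'x^'u \<Rightarrow> real^'x^'x \<Rightarrow> real^'x^'x" where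
  "f_fn A B K P = (1/2) *\<^sub>R (transpose (A + B ** K - P) ** (A + B ** K - P))"

definition L_f :: "real^'x^'x \<Rightarrow> real^'u^'x \<Rightarrow> real^'x^'u \<Rightarrow> real^'x^'x \<Rightarrow>
    real^'x^'u \<Rightarrow> real^'x^'x \<Rightarrow> real^'x^'x" where
  "L_f A B K P Kt Pt = f_fn A B Kt Pt
     + (1/2) *\<^sub>R (transpose (B ** (K - Kt) - (P - Pt)) ** (A + B ** Kt - Pt))
     + (1/2) *\<^sub>R (transpose (A + B ** Kt - Pt) ** (B ** (K - Kt) - (P - Pt)))"

record 'v min_problem =
  objective :: "'v \<Rightarrow> real"
  constraints :: "'v \<Rightarrow> bool"

definition feasible_solution :: "'v min_problem \<Rightarrow> 'v \<Rightarrow> bool" where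
  "feasible_solution p v \<longleftrightarrow> constraints p v"

definition problem_P :: "real^'x^'x \<Rightarrow> real^'u^'x \<Rightarrow> real^'d^'x \<Rightarrow> real^'x^'z \<Rightarrow> real^'u^'z \<Rightarrow>
    real^'d^'z \<Rightarrow> real \<Rightarrow> ((real^'x^'u) \<times> (real^'x^'x)) min_problem" where
  "problem_P A B G C D H \<gamma> = \<lparr>
     objective = (\<lambda>(K, P). entrywise_norm1 K),
     constraints = (\<lambda>(K, P). P \<in> symmetric_matrices \<and> 0 \<prec>\<^sub>m P \<and>
       (Sym (P ** (A + B ** K)) ||| P ** G              ||| transpose (C + D ** K) ///
        transpose G ** P        ||| - (\<gamma> *\<^sub>R mat 1)    ||| transpose H            ///
        C + D ** K              ||| H                   ||| - (\<gamma> *\<^sub>R mat 1)) \<preceq>\<^sub>m 0) \<rparr>"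

definition problem_R :: "real^'x^'x \<Rightarrow> real^'u^'x \<Rightarrow> real^'d^'x \<Rightarrow> real^'x^'z \<Rightarrow> real^'u^'z \<Rightarrow>
    real^'d^'z \<Rightarrow> real \<Rightarrow> real^'x^'u \<Rightarrow> real^'x^'x \<Rightarrow> ((real^'x^'u) \<times> (real^'x^'x)) min_problem" where
  "problem_R A B G C D H \<gamma> Kt Pt = \<lparr>
     objective = (\<lambda>(K, P). entrywise_norm1 K),
     constraints = (\<lambda>(K, P). P \<in> symmetric_matrices \<and> 0 \<prec>\<^sub>m P \<and>
       (let M21 = (1 / sqrt 2) *\<^sub>R (A + B ** K + P); M31 = transpose G ** P; M41 = C + D ** K in
         - L_f A B K P Kt Pt ||| transpose M21 ||| transpose M31   ||| transpose M41   ///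
         M21                 ||| - mat 1       ||| 0               ||| 0               ///
         M31                 ||| 0             ||| - (\<gamma> *\<^sub>R mat 1) ||| transpose H     ///
         M41                 ||| 0             ||| H               ||| - (\<gamma> *\<^sub>R mat 1)) \<preceq>\<^sub>m 0) \<rparr>"

end

theory Submission
  imports Defs
begin

text \<open>
  Write \<open>M = A + B ** K\<close> and \<open>F = (M + P) / sqrt 2\<close>. For symmetric \<open>P\<close> the only nonconvex term of the
  bounded-real inequality is a difference of two convex matrix functions,
  \<open>Sym (P ** M) = transpose F ** F - f K P\<close> (\<open>Sym_eq_difference_of_squares\<close>). Because \<open>f\<close> is a square
  of an affine function, it lies above its linearization \<open>L_f\<close> in the semidefinite order, with
  equality at the linearization point (\<open>L_f_le_f\<close>, \<open>L_f_self\<close>). Replacing \<open>f\<close> by \<open>L_f\<close> therefore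
  enlarges the leading block and makes the inequality harder to satisfy
  (\<open>block_nsd_antimono\<close>).

  The remaining square \<open>transpose F ** F\<close> is turned into a block row and column containing only the
  affine \<open>F\<close> by a Schur complement with respect to a block \<open>- mat 1\<close>
  (\<open>block_nsd_iff_schur_complement\<close>). Thus the constraint of the convex problem says exactly that the
  original block matrix, with \<open>f\<close> replaced by \<open>L_f\<close>, is negative semidefinite. Both claims follow:
  the constraint is stronger than the original one, and equivalent to it when the linearization
  point is \<open>(K, P)\<close> itself.
\<close>

section \<open>Block matrices and block vectors\<close>

definition upper_part :: "real^('a::finite + 'b::finite) \<Rightarrow> real^'a" where
  "upper_part w = (\<chi> i. w $ Inl i)"

definition lower_part :: "real^('a::finite + 'b::finite) \<Rightarrow> real^'b" where
  "lower_part w = (\<chi> i. w $ Inr i)"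

definition append_vec :: "real^'a::finite \<Rightarrow> real^'b::finite \<Rightarrow> real^('a + 'b)" where
  "append_vec x y = (\<chi> i. case i of Inl a \<Rightarrow> x $ a | Inr b \<Rightarrow> y $ b)"

lemma parts_append_vec [simp]:
  "upper_part (append_vec x y) = x" "lower_part (append_vec x y) = y"
  by (simp_all add: upper_part_def lower_part_def append_vec_def vec_eq_iff)

lemma sum_UNIV_Plus:
  fixes g :: "'a::finite + 'b::finite \<Rightarrow> 'c::comm_monoid_add"
  shows "(\<Sum>i\<in>UNIV. g i) = (\<Sum>a\<in>UNIV. g (Inl a)) + (\<Sum>b\<in>UNIV. g (Inr b))"
  by (simp add: UNIV_Plus_UNIV [symmetric] sum.Plus del: UNIV_Plus_UNIV)

lemma hcat_mult_vec: "(M ||| N) *v w = M *v upper_part w + N *v lower_part w"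
  by (simp add: vec_eq_iff matrix_vector_mult_def hcat_def sum_UNIV_Plus upper_part_def
      lower_part_def)

lemma inner_vcat_mult_vec:
  "w \<bullet> ((M /// N) *v v) = upper_part w \<bullet> (M *v v) + lower_part w \<bullet> (N *v v)"
  by (simp add: inner_vec_def matrix_vector_mult_def vcat_def sum_UNIV_Plus upper_part_def
      lower_part_def)

lemmas block_form = hcat_mult_vec inner_vcat_mult_vec inner_add_right

lemma interchange_blocks: "(M ||| N) /// (X ||| Y) = (M /// X) ||| (N /// Y)"
  by (auto simp: vec_eq_iff hcat_def vcat_def split: sum.splits)

lemma hcat_zero: "0 ||| 0 = 0"
  and vcat_zero: "0 /// 0 = 0"
  by (auto simp: vec_eq_iff hcat_def vcat_def split: sum.splits)

lemma group_rows: "(X ||| 0 ||| M) /// (Y ||| 0 ||| N) = (X /// Y) ||| 0 ||| (M /// N)"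
  by (simp add: interchange_blocks vcat_zero)

lemma transpose_hcat: "transpose (M ||| N) = transpose M /// transpose N"
  by (auto simp: vec_eq_iff hcat_def vcat_def transpose_def split: sum.splits)

lemma vcat_eq_iff: "M /// N = X /// Y \<longleftrightarrow> M = X \<and> N = Y"
  by (auto simp: vec_eq_iff vcat_def split_sum_all)

lemma transpose_zero: "transpose (0 :: real^'n^'m) = 0"
  by (simp add: vec_eq_iff transpose_def)

lemma block_symmetric_iff:
  "(M ||| N) /// (X ||| Y) \<in> symmetric_matrices \<longleftrightarrow>
     M \<in> symmetric_matrices \<and> X = transpose N \<and> Y \<in> symmetric_matrices"
  unfolding symmetric_matrices_def
  by (auto simp: vec_eq_iff hcat_def vcat_def transpose_def split_sum_all)

section \<open>Negative semidefinite block matrices\<close>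

lemma symmetric_gram: "transpose F ** F \<in> symmetric_matrices"
  for F :: "real^'n^'m"
  by (simp add: symmetric_matrices_def matrix_transpose_mul)

lemma symmetric_add_iff:
  "N \<in> symmetric_matrices \<Longrightarrow> M + N \<in> symmetric_matrices \<longleftrightarrow> M \<in> symmetric_matrices"
  by (auto simp: symmetric_matrices_def vec_eq_iff transpose_def)

lemma symmetric_diff:
  "M \<in> symmetric_matrices \<Longrightarrow> N \<in> symmetric_matrices \<Longrightarrow> M - N \<in> symmetric_matrices"
  by (auto simp: symmetric_matrices_def vec_eq_iff transpose_def)

lemma symmetric_uminus_mat_1:
  "- mat 1 \<in> symmetric_matrices"
  by (auto simp: symmetric_matrices_def vec_eq_iff transpose_def mat_def)

lemma uminus_mult_vec: "(- M) *v x = - (M *v x)"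
  for M :: "real^'n^'m"
  by (simp add: vec_eq_iff matrix_vector_mult_def sum_negf)

lemma nsd_iff:
  "M \<preceq>\<^sub>m 0 \<longleftrightarrow> M \<in> symmetric_matrices \<and> (\<forall>x. x \<bullet> (M *v x) \<le> 0)"
  by (auto simp: loewner_le_def symmetric_matrices_def transpose_zero uminus_mult_vec)

lemma inner_gram: "x \<bullet> ((transpose F ** F) *v x) = (F *v x) \<bullet> (F *v x)"
  for F :: "real^'n^'m"
  by (metis dot_lmul_matrix inner_commute matrix_vector_mul_assoc transpose_matrix_vector)

lemma block_nsd_antimono:
  assumes "M \<preceq>\<^sub>m M'" and "(M' ||| N) /// (X ||| Y) \<preceq>\<^sub>m 0"
  shows "(M ||| N) /// (X ||| Y) \<preceq>\<^sub>m 0"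
proof -
  have "x \<bullet> (M *v x) \<le> x \<bullet> (M' *v x)" for x
    using assms(1)
    by (simp add: loewner_le_def matrix_vector_mult_diff_rdistrib inner_diff_right)
  moreover have "M \<in> symmetric_matrices"
    using assms(1) by (simp add: loewner_le_def)
  ultimately show ?thesis
    using assms(2) unfolding nsd_iff block_symmetric_iff block_form
    by (smt (verit))
qed

text \<open>
  For fixed \<open>x\<close> and \<open>y\<close>, the quadratic form of the large matrix depends on the middle vector \<open>e\<close>
  through \<open>2 * (e \<bullet> (F *v x)) - e \<bullet> e\<close>. Completing the square shows that its maximum
  \<open>(F *v x) \<bullet> (F *v x)\<close> is attained at \<open>e = F *v x\<close>, so maximizing out \<open>e\<close> adds the Gram matrix of
  \<open>F\<close> to the leading block.
\<close>

lemma block_nsd_iff_schur_complement: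
  fixes F :: "real^'n^'m" and N :: "real^'p^'n"
  shows "(M ||| transpose F ||| N) /// (F ||| - mat 1 ||| 0) /// (X ||| 0 ||| Y) \<preceq>\<^sub>m 0 \<longleftrightarrow>
    (M + transpose F ** F ||| N) /// (X ||| Y) \<preceq>\<^sub>m 0"
    (is "?L \<preceq>\<^sub>m 0 \<longleftrightarrow> ?S \<preceq>\<^sub>m 0")
proof -
  define q where "q x y = x \<bullet> (M *v x) + x \<bullet> (N *v y) + y \<bullet> (X *v x) + y \<bullet> (Y *v y)" for x y
  have transpose_inner: "x \<bullet> (e v* F) = e \<bullet> (F *v x)" for x e
    by (metis dot_lmul_matrix inner_commute)
  have large: "w \<bullet> (?L *v w) = q x y + 2 * (e \<bullet> (F *v x)) - e \<bullet> e"
    if "x = upper_part w" "e = upper_part (lower_part w)" "y = lower_part (lower_part w)"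
    for w x e y
    by (simp add: that block_form q_def transpose_inner uminus_mult_vec inner_diff_right)
  have small: "v \<bullet> (?S *v v) = q x y + (F *v x) \<bullet> (F *v x)"
    if "x = upper_part v" "y = lower_part v" for v x y
    by (simp add: that block_form q_def inner_gram matrix_vector_mult_add_rdistrib)
  have square: "2 * (e \<bullet> a) - e \<bullet> e \<le> a \<bullet> a" for e a :: "real^'m"
    using inner_ge_zero [of "e - a"] by (simp add: inner_diff inner_commute)
  have forms: "(\<forall>w. w \<bullet> (?L *v w) \<le> 0) \<longleftrightarrow> (\<forall>v. v \<bullet> (?S *v v) \<le> 0)"
  proof (intro iffI allI)
    fix v assume "\<forall>w. w \<bullet> (?L *v w) \<le> 0"
    then have "append_vec x (append_vec (F *v x) y) \<bullet>
        (?L *v append_vec x (append_vec (F *v x) y)) \<le> 0"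
      if "x = upper_part v" "y = lower_part v" for x y
      by blast
    then show "v \<bullet> (?S *v v) \<le> 0"
      by (simp add: large small add.commute)
  next
    fix w :: "real^('n + 'm + 'p)" assume v: "\<forall>v. v \<bullet> (?S *v v) \<le> 0"
    let ?x = "upper_part w" and ?e = "upper_part (lower_part w)"
      and ?y = "lower_part (lower_part w)"
    have "append_vec ?x ?y \<bullet> (?S *v append_vec ?x ?y) \<le> 0"
      using v by blast
    then show "w \<bullet> (?L *v w) \<le> 0"
      using square [of ?e "F *v ?x"] by (simp add: large small)
  qed
  have L: "?L = (M ||| (transpose F ||| N)) /// ((F /// X) ||| ((- mat 1 ||| 0) /// (0 ||| Y)))"
    by (simp only: interchange_blocks)
  have "?L \<in> symmetric_matrices \<longleftrightarrow> ?S \<in> symmetric_matrices"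
    unfolding L block_symmetric_iff transpose_hcat vcat_eq_iff
    by (simp add: symmetric_add_iff symmetric_gram symmetric_uminus_mat_1 transpose_zero)
  then show ?thesis
    using forms by (simp add: nsd_iff)
qed

section \<open>The difference-of-squares decomposition and its linearization\<close>

lemma matrix_mult_diff:
  fixes X Y :: "real^'n^'m" and Z W :: "real^'p^'n"
  shows "(X - Y) ** Z = X ** Z - Y ** Z" "X ** (Z - W) = X ** Z - X ** W"
  by (simp_all add: vec_eq_iff matrix_matrix_mult_def sum_subtractf algebra_simps)

lemma matrix_add_rdistrib: "(X + Y) ** Z = X ** Z + Y ** Z"
  for X Y :: "real^'n^'m" and Z :: "real^'p^'n"
  by (simp add: vec_eq_iff matrix_matrix_mult_def sum.distrib algebra_simps)

lemma transpose_add: "transpose (X + Y) = transpose X + transpose Y"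
  and transpose_diff: "transpose (X - Y) = transpose X - transpose Y"
  and transpose_scaleR: "transpose (c *\<^sub>R X) = c *\<^sub>R transpose X"
  for X Y :: "real^'n^'m"
  by (simp_all add: vec_eq_iff transpose_def)

lemma scaleR_matrix_mult:
  fixes X :: "real^'n^'m" and Y :: "real^'p^'n"
  shows "(c *\<^sub>R X) ** Y = c *\<^sub>R (X ** Y)" "X ** (c *\<^sub>R Y) = c *\<^sub>R (X ** Y)"
  by (simp_all add: vec_eq_iff matrix_matrix_mult_def sum_distrib_left algebra_simps)

lemmas matrix_ring_simps = matrix_mult_diff matrix_add_ldistrib matrix_add_rdistrib
  transpose_add transpose_diff transpose_scaleR scaleR_matrix_mult matrix_transpose_mul

lemma Sym_eq_difference_of_squares:
  fixes B :: "real^'u^'x" and K :: "real^'x^'u" and A P :: "real^'x^'x"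
  assumes "P \<in> symmetric_matrices"
  defines "F \<equiv> (1 / sqrt 2) *\<^sub>R (A + B ** K + P)"
  shows "Sym (P ** (A + B ** K)) = - f_fn A B K P + transpose F ** F"
proof -
  define M where "M = A + B ** K"
  have P: "transpose P = P"
    using assms(1) by (simp add: symmetric_matrices_def)
  have gram: "transpose F ** F = (1/2) *\<^sub>R (transpose (M + P) ** (M + P))"
    by (simp add: F_def M_def transpose_scaleR scaleR_matrix_mult)
  have f: "f_fn A B K P = (1/2) *\<^sub>R (transpose (M - P) ** (M - P))"
    by (simp add: f_fn_def M_def)
  have Sym: "Sym (P ** M) = P ** M + transpose M ** P"
    by (simp add: Sym_def matrix_transpose_mul P)
  show ?thesis
    unfolding M_def [symmetric] gram f Sym
    by (simp add: matrix_ring_simps P) (simp add: vec_eq_iff field_simps)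
qed

text \<open>
  With \<open>R\<close> the residual \<open>A + B ** Kt - Pt\<close> and \<open>S\<close> its increment, \<open>f\<close> is half the Gram matrix of
  \<open>R + S\<close>. Linearizing drops only the second-order term, half the Gram matrix of \<open>S\<close>.
\<close>

lemma f_eq_L_f_plus_square:
  fixes B :: "real^'u^'x" and K Kt :: "real^'x^'u" and A P Pt :: "real^'x^'x"
  defines "S \<equiv> B ** (K - Kt) - (P - Pt)"
  shows "f_fn A B K P = L_f A B K P Kt Pt + (1/2) *\<^sub>R (transpose S ** S)"
proof -
  define R where "R = A + B ** Kt - Pt"
  have increment: "A + B ** K - P = R + S"
    by (simp add: R_def S_def matrix_mult_diff)
  show ?thesis
    unfolding L_f_def f_fn_def increment R_def [symmetric] S_def [symmetric]
    by (simp add: matrix_ring_simps) (simp add: vec_eq_iff field_simps)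
qed

lemma L_f_self: "L_f A B K P K P = f_fn A B K P"
  by (simp add: L_f_def vec_eq_iff transpose_def matrix_matrix_mult_def)

lemma symmetric_half_gram: "(1/2) *\<^sub>R (transpose S ** S) \<in> symmetric_matrices"
  for S :: "real^'n^'m"
  using symmetric_gram [of S] by (simp add: symmetric_matrices_def transpose_scaleR)

lemma L_f_le_f: "L_f A B K P Kt Pt \<preceq>\<^sub>m f_fn A B K P"
proof -
  define S where "S = B ** (K - Kt) - (P - Pt)"
  have f: "f_fn A B K P = L_f A B K P Kt Pt + (1/2) *\<^sub>R (transpose S ** S)"
    unfolding S_def by (rule f_eq_L_f_plus_square)
  have "f_fn A B K P \<in> symmetric_matrices"
    unfolding f_fn_def by (rule symmetric_half_gram)
  moreover from this have "L_f A B K P Kt Pt \<in> symmetric_matrices"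
    using symmetric_add_iff [OF symmetric_half_gram] f by metis
  moreover have "0 \<le> x \<bullet> (((1/2) *\<^sub>R (transpose S ** S)) *v x)" for x
    by (simp add: scaleR_matrix_vector_assoc [symmetric] inner_gram)
  ultimately show ?thesis
    by (simp add: loewner_le_def f)
qed

section \<open>Comparison of the two problems\<close>

text \<open>
  Grouping the performance rows and columns turns the constraints of both problems into two-by-two
  block inequalities that differ only in whether the leading block uses \<open>f\<close> or \<open>L_f\<close>.
\<close>

lemma feasible_P_iff:
  fixes A :: "real^'x^'x" and B :: "real^'u^'x" and C :: "real^'x^'z"
  defines "F \<equiv> \<lambda>K P. (1 / sqrt 2) *\<^sub>R (A + B ** K + P)"
  shows "feasible_solution (problem_P A B G C D H \<gamma>) (K, P) \<longleftrightarrow>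
    P \<in> symmetric_matrices \<and> 0 \<prec>\<^sub>m P \<and>
    ((- f_fn A B K P + transpose (F K P) ** F K P) |||
      transpose (transpose G ** P) ||| transpose (C + D ** K)) ///
    ((transpose G ** P /// C + D ** K) |||
      ((- (\<gamma> *\<^sub>R mat 1) ||| transpose H) /// (H ||| - (\<gamma> *\<^sub>R mat 1)))) \<preceq>\<^sub>m 0"
proof (cases "P \<in> symmetric_matrices")
  case True
  then have "P ** G = transpose (transpose G ** P)"
    by (simp add: symmetric_matrices_def matrix_transpose_mul)
  then show ?thesis
    unfolding feasible_solution_def problem_P_def F_def
      Sym_eq_difference_of_squares [OF True, of A B K, symmetric]
    by (simp add: interchange_blocks)
qed (simp add: feasible_solution_def problem_P_def)

lemma feasible_R_iff:
  fixes A :: "real^'x^'x" and B :: "real^'u^'x" and C :: "real^'x^'z"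
  defines "F \<equiv> \<lambda>K P. (1 / sqrt 2) *\<^sub>R (A + B ** K + P)"
  shows "feasible_solution (problem_R A B G C D H \<gamma> Kt Pt) (K, P) \<longleftrightarrow>
    P \<in> symmetric_matrices \<and> 0 \<prec>\<^sub>m P \<and>
    ((- L_f A B K P Kt Pt + transpose (F K P) ** F K P) |||
      transpose (transpose G ** P) ||| transpose (C + D ** K)) ///
    ((transpose G ** P /// C + D ** K) |||
      ((- (\<gamma> *\<^sub>R mat 1) ||| transpose H) /// (H ||| - (\<gamma> *\<^sub>R mat 1)))) \<preceq>\<^sub>m 0"
  unfolding feasible_solution_def problem_R_def F_def
  by (simp only: min_problem.simps prod.case Let_def hcat_zero group_rows
      block_nsd_iff_schur_complement)

theorem theorem3:
  fixes A :: "real^'x^'x" and B :: "real^'u^'x" and G :: "real^'d^'x"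
    and C :: "real^'x^'z" and D :: "real^'u^'z" and H :: "real^'d^'z"
    and \<gamma> :: real
  assumes "stabilizable A B"
  shows "(\<forall>(Kt :: real^'x^'u) (Pt :: real^'x^'x). Pt \<in> symmetric_matrices \<longrightarrow>
            (\<forall>Kbar Pbar. feasible_solution (problem_R A B G C D H \<gamma> Kt Pt) (Kbar, Pbar) \<longrightarrow>
               feasible_solution (problem_P A B G C D H \<gamma>) (Kbar, Pbar))) \<and>
         (\<forall>(Khat :: real^'x^'u) (Phat :: real^'x^'x).
            feasible_solution (problem_P A B G C D H \<gamma>) (Khat, Phat) \<longrightarrow>
            feasible_solution (problem_R A B G C D H \<gamma> Khat Phat) (Khat, Phat))"
proof (intro conjI allI impI)
  fix Kt K :: "real^'x^'u" and Pt P :: "real^'x^'x"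
  assume "feasible_solution (problem_R A B G C D H \<gamma> Kt Pt) (K, P)"
  moreover have "- f_fn A B K P + transpose F ** F \<preceq>\<^sub>m - L_f A B K P Kt Pt + transpose F ** F"
    for F :: "real^'x^'x"
    using L_f_le_f [of A B K P Kt Pt]
    by (simp add: loewner_le_def symmetric_diff symmetric_gram)
  ultimately show "feasible_solution (problem_P A B G C D H \<gamma>) (K, P)"
    unfolding feasible_P_iff feasible_R_iff using block_nsd_antimono by blast
next
  fix K :: "real^'x^'u" and P :: "real^'x^'x"
  assume "feasible_solution (problem_P A B G C D H \<gamma>) (K, P)"
  then show "feasible_solution (problem_R A B G C D H \<gamma> K P) (K, P)"
    by (simp add: feasible_P_iff feasible_R_iff L_f_self)
qed

end
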